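(* Suppose $n$ units are partitioned into $b$ blocks, block $c$ having $n_c\ge r$ units, with fixed potential outcomes $y_{kcs}\in\mathbb{R}$. Under balanced block randomization, for any treatments $s$ and $t$ with $s\neq t$: $$\mathbb{E}(\hat\delta_{st,\mathrm{HT}})=\delta_{st},$$ $$\mathrm{Var}(\hat\delta_{st,\mathrm{HT}})=\sum_{c=1}^b\frac{n_c^2}{n^2}\left(\frac{r-1}{n_c-1}(\sigma_{cs}^2+\sigma_{ct}^2)+2\frac{\gamma_{cst}}{n_c-1}\right)+\sum_{c=1}^b\frac{n_c^2}{n^2}\,\frac{z_c(r-z_c)}{n_c^3(r-1)}\sum_{k=1}^{n_c}\sum_{\ell\neq k}\left(\frac{r-1}{n_c-1}\left(y_{kcs}y_{\ell cs}+y_{kct}y_{\ell ct}\right)+2\frac{y_{kcs}y_{\ell ct}}{n_c-1}\right).$$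
   Context: There are $n$ units and $r$ treatments; each unit is assigned exactly one treatment. The units are partitioned into blocks $c=1,\dots,b$; block $c$ has $n_c$ units, $(k,c)$ denotes the $k$-th unit of block $c$ ($1\le k\le n_c$), and $z_c$ is the remainder of $n_c$ divided by $r$ ($0\le z_c<r$). Balanced block randomization means: independently across blocks, the treatment assignment within block $c$ is drawn uniformly at random from all balanced assignments of that block, i.e. assignments in which exactly $z_c$ of the treatments are each given to $\lfloor n_c/r\rfloor+1$ units and the other $r-z_c$ treatments are each given to $\lfloor n_c/r\rfloor$ units. $T_{kcs}$ is the indicator that unit $(k,c)$ receives treatment $s$. The potential outcome $y_{kcs}$ of unit $(k,c)$ under treatment $s$ is non-random. Define the block-level parameters $$\mu_{cs}=\frac1{n_c}\sum_{k=1}^{n_c}y_{kcs},\quad \sigma_{cs}^2=\frac1{n_c}\sum_{k=1}^{n_c}(y_{kcs}-\mu_{cs})^2,\quad \gamma_{cst}=\frac1{n_c}\sum_{k=1}^{n_c}(y_{kcs}-\mu_{cs})(y_{kct}-\mu_{ct}),$$ the sample average treatment effect of $s$ relative to $t$ $$\delta_{st}=\frac1n\sum_{c=1}^b\sum_{k=1}^{n_c}(y_{kcs}-y_{kct}),$$ and the Horvitz-Thompson estimator $$\hat\delta_{st,\mathrm{HT}}=\sum_{c=1}^b\frac{n_c}{n}\sum_{k=1}^{n_c}\left(\frac{y_{kcs}T_{kcs}}{n_c/r}-\frac{y_{kct}T_{kct}}{n_c/r}\right).$$ Sums $\sum_{k}\sum_{\ell\ne k}$ run over all ordered pairs of distinct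 indices in $\{1,\dots,n_c\}$. *)

theory Defs
  imports "HOL-Probability.Probability" "HOL-Probability.Product_PMF"
begin

text \<open>
  Blocks are \<open>{1..b}\<close>, treatments are \<open>{1..r}\<close>, and the units of a block of size \<open>m\<close> are
  \<open>{1..m}\<close>. The function \<open>nc\<close> gives the block sizes, \<open>y k c s\<close> is the potential outcome of
  unit \<open>(k,c)\<close> under treatment \<open>s\<close>, and for an assignment \<open>W\<close> the treatment given to
  unit \<open>(k,c)\<close> is \<open>W c k\<close>.
\<close>

definition group_size :: "nat \<Rightarrow> (nat \<Rightarrow> nat) \<Rightarrow> nat \<Rightarrow> nat" where
  "group_size m w s = card {k \<in> {1..m}. w k = s}"

definition balanced_assignments :: "nat \<Rightarrow> nat \<Rightarrow> (nat \<Rightarrow> nat) set" where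
  "balanced_assignments r m =
     {w \<in> {1..m} \<rightarrow>\<^sub>E {1..r}.
        card {s \<in> {1..r}. group_size m w s = m div r + 1} = m mod r \<and>
        (\<forall>s\<in>{1..r}. group_size m w s = m div r + 1 \<or> group_size m w s = m div r)}"

text \<open>
  \<^const>\<open>pmf_of_set\<close> is the uniform distribution only on a finite nonempty set;
  both properties are established below.
\<close>

lemma finite_balanced_assignments: "finite (balanced_assignments r m)"
  unfolding balanced_assignments_def
  by (rule finite_subset[OF _ finite_PiE[of "{1..m}" "\<lambda>_. {1..r}"]]) auto

lemma card_residue_class:
  assumes "0 < r" "j < r"
  shows "card {k \<in> {1..m}. (k - 1) mod r = j} = m div r + (if j < m mod r then 1 else (0::nat))"
proof (induction m)
  case (Suc m)
  have "{k \<in> {1..Suc m}. (k - 1) mod r = j} =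
        {k \<in> {1..m}. (k - 1) mod r = j} \<union> (if m mod r = j then {Suc m} else {})"
    by (auto simp: le_Suc_eq)
  moreover have "card ({k \<in> {1..m}. (k - 1) mod r = j} \<union> (if m mod r = j then {Suc m} else {})) =
        card {k \<in> {1..m}. (k - 1) mod r = j} + (if m mod r = j then 1 else 0)"
    by auto
  ultimately have "card {k \<in> {1..Suc m}. (k - 1) mod r = j} =
      m div r + (if j < m mod r then 1 else 0) + (if m mod r = j then 1 else 0)"
    using Suc.IH by simp
  also have "\<dots> = Suc m div r + (if j < Suc m mod r then 1 else 0)"
    using assms by (auto simp: div_Suc mod_Suc)
  finally show ?case .
qed (use assms in simp)

lemma balanced_assignments_nonempty:
  assumes "0 < r"
  shows "balanced_assignments r m \<noteq> {}"
proof -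
  define w where "w = (\<lambda>k\<in>{1..m}. (k - 1) mod r + 1)"
  have w: "w \<in> {1..m} \<rightarrow>\<^sub>E {1..r}"
    using assms by (auto simp: w_def Suc_le_eq)
  have g: "group_size m w s = m div r + (if s - 1 < m mod r then 1 else 0)" if "s \<in> {1..r}" for s
  proof -
    have "{k \<in> {1..m}. w k = s} = {k \<in> {1..m}. (k - 1) mod r = s - 1}"
      using that by (auto simp: w_def)
    then show ?thesis
      unfolding group_size_def using card_residue_class[of r "s - 1" m] that assms by auto
  qed
  have "m mod r < r"
    using assms by simp
  have "s \<in> {1..r} \<and> group_size m w s = m div r + 1 \<longleftrightarrow> s \<in> {1..m mod r}" for s
  proof (cases "s \<in> {1..r}")
    case True
    then have "group_size m w s = m div r + 1 \<longleftrightarrow> s - 1 < m mod r"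
      by (simp only: g split: if_split) simp
    then show ?thesis using True by auto
  next
    case False
    then show ?thesis using \<open>m mod r < r\<close> by auto
  qed
  then have "{s \<in> {1..r}. group_size m w s = m div r + 1} = {1..m mod r}"
    by blast
  moreover have "\<forall>s\<in>{1..r}. group_size m w s = m div r + 1 \<or> group_size m w s = m div r"
    by (simp add: g)
  ultimately have "w \<in> balanced_assignments r m"
    using w unfolding balanced_assignments_def by simp
  then show ?thesis by blast
qed

definition balanced_block_randomization ::
    "nat \<Rightarrow> nat \<Rightarrow> (nat \<Rightarrow> nat) \<Rightarrow> (nat \<Rightarrow> nat \<Rightarrow> nat) pmf" where
  "balanced_block_randomization r b nc =
     Pi_pmf {1..b} undefined (\<lambda>c. pmf_of_set (balanced_assignments r (nc c)))"

definition treated :: "(nat \<Rightarrow> nat \<Rightarrow> nat) \<Rightarrow> nat \<Rightarrow> nat \<Rightarrow> nat \<Rightarrow> real" where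
  "treated W k c s = of_bool (W c k = s)"

definition block_mean :: "(nat \<Rightarrow> nat) \<Rightarrow> (nat \<Rightarrow> nat \<Rightarrow> nat \<Rightarrow> real) \<Rightarrow> nat \<Rightarrow> nat \<Rightarrow> real" where
  "block_mean nc y c s = 1 / nc c * (\<Sum>k=1..nc c. y k c s)"

definition block_var :: "(nat \<Rightarrow> nat) \<Rightarrow> (nat \<Rightarrow> nat \<Rightarrow> nat \<Rightarrow> real) \<Rightarrow> nat \<Rightarrow> nat \<Rightarrow> real" where
  "block_var nc y c s = 1 / nc c * (\<Sum>k=1..nc c. (y k c s - block_mean nc y c s)\<^sup>2)"

definition block_cov ::
    "(nat \<Rightarrow> nat) \<Rightarrow> (nat \<Rightarrow> nat \<Rightarrow> nat \<Rightarrow> real) \<Rightarrow> nat \<Rightarrow> nat \<Rightarrow> nat \<Rightarrow> real" where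
  "block_cov nc y c s t =
     1 / nc c * (\<Sum>k=1..nc c. (y k c s - block_mean nc y c s) * (y k c t - block_mean nc y c t))"

definition sample_ate ::
    "nat \<Rightarrow> nat \<Rightarrow> (nat \<Rightarrow> nat) \<Rightarrow> (nat \<Rightarrow> nat \<Rightarrow> nat \<Rightarrow> real) \<Rightarrow> nat \<Rightarrow> nat \<Rightarrow> real" where
  "sample_ate n b nc y s t = 1 / n * (\<Sum>c=1..b. \<Sum>k=1..nc c. y k c s - y k c t)"

definition horvitz_thompson ::
    "nat \<Rightarrow> nat \<Rightarrow> nat \<Rightarrow> (nat \<Rightarrow> nat) \<Rightarrow> (nat \<Rightarrow> nat \<Rightarrow> nat \<Rightarrow> real) \<Rightarrow> nat \<Rightarrow> nat \<Rightarrow>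
     (nat \<Rightarrow> nat \<Rightarrow> nat) \<Rightarrow> real" where
  "horvitz_thompson n r b nc y s t W =
     (\<Sum>c=1..b. nc c / n *
        (\<Sum>k=1..nc c. y k c s * treated W k c s / (nc c / r) - y k c t * treated W k c t / (nc c / r)))"

end

theory Submission
  imports Defs
begin

text \<open>
  Blocks are independent, so the variance is a sum of block variances. Within a block the uniform
  distribution on balanced assignments is invariant under permuting units and under permuting
  treatments. Hence a unit receives each treatment with probability \<open>1 / r\<close>, and the probability
  that two distinct units both receive a given treatment depends neither on the units nor on the
  treatment; since the sum of the squared group sizes is the same for all balanced assignments,
  summing over units and treatments determines it. Summing the joint probabilities over the
  treatment of the second unit then gives the case of two different treatments.
\<close>

section \<open>Variance of a sum over independent coordinates\<close>

lemma variance_mult_left: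
  fixes a :: real
  shows "measure_pmf.variance M (\<lambda>x. a * X x) = a\<^sup>2 * measure_pmf.variance M X"
  by (simp only: integral_mult_right_zero right_diff_distrib[symmetric] power_mult_distrib)

text \<open>Centring each summand at its own mean does not change the variance of the sum. By
  independence the products of different centred summands have mean zero, so only the diagonal of
  the expanded square survives. Finite supports make every function integrable.\<close>

lemma variance_sum_Pi_pmf:
  fixes f :: "'a \<Rightarrow> 'b \<Rightarrow> real"
  assumes A: "finite A" and p: "\<And>x. x \<in> A \<Longrightarrow> finite (set_pmf (p x))"
  shows "measure_pmf.variance (Pi_pmf A dflt p) (\<lambda>W. \<Sum>x\<in>A. f x (W x)) =
    (\<Sum>x\<in>A. measure_pmf.variance (p x) (f x))"
proof -
  let ?P = "Pi_pmf A dflt p"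
  define g where "g x v = f x v - measure_pmf.expectation (p x) (f x)" for x v
  have "finite (set_pmf ?P)"
    using assms by (auto simp: set_Pi_pmf intro!: finite_PiE_dflt)
  then have int: "integrable ?P h" for h :: "_ \<Rightarrow> real"
    by (rule integrable_measure_pmf_finite)
  \<comment> \<open>The marginal of the product distribution at a coordinate \<open>x\<close> in
    \<open>A\<close> is \<open>p x\<close>.\<close>
  have comp: "measure_pmf.expectation ?P (\<lambda>W. h (W x)) = measure_pmf.expectation (p x) h"
    if "x \<in> A" for x and h :: "'b \<Rightarrow> real"
    using Pi_pmf_component[OF A, of x dflt p] that integral_map_pmf[of "\<lambda>W. W x" ?P h] by simp
  have mean: "measure_pmf.expectation ?P (\<lambda>W. g x (W x)) = 0" if "x \<in> A" for x
  proof -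
    have "measure_pmf.expectation (p x) (g x) = 0"
      using integrable_measure_pmf_finite[OF p[OF that], of "f x"]
      by (simp add: g_def[abs_def])
    then show ?thesis using comp[OF that, of "g x"] by simp
  qed
  have off: "measure_pmf.expectation ?P (\<lambda>W. g x (W x) * g x' (W x')) = 0"
    if x: "x \<in> A" "x' \<in> A" "x \<noteq> x'" for x x'
  proof -
    \<comment> \<open>Restricting to two coordinates and composing with \<open>g\<close> gives
      independent real variables, so the expectation of their product is a product of two
      zeros.\<close>
    have "prob_space.indep_vars ?P (\<lambda>_. count_space UNIV) (\<lambda>x W. W x) {x, x'}"
      using x by (intro prob_space.indep_vars_subset[OF measure_pmf.prob_space_axioms
            indep_vars_Pi_pmf[OF A]]) auto
    then have "prob_space.indep_vars ?P (\<lambda>_. borel) (\<lambda>x W. g x (W x)) {x, x'}"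
      by (rule prob_space.indep_vars_compose2[OF measure_pmf.prob_space_axioms]) auto
    then have "measure_pmf.expectation ?P (\<lambda>W. \<Prod>i\<in>{x, x'}. g i (W i)) =
        (\<Prod>i\<in>{x, x'}. measure_pmf.expectation ?P (\<lambda>W. g i (W i)))"
      by (intro prob_space.indep_vars_lebesgue_integral[OF measure_pmf.prob_space_axioms] int) auto
    then show ?thesis using x mean by simp
  qed
  have "measure_pmf.variance ?P (\<lambda>W. \<Sum>x\<in>A. f x (W x)) =
      measure_pmf.expectation ?P (\<lambda>W. (\<Sum>x\<in>A. g x (W x))\<^sup>2)"
    by (simp add: int comp g_def sum_subtractf)
  also have "\<dots> = (\<Sum>x\<in>A. \<Sum>x'\<in>A. measure_pmf.expectation ?P (\<lambda>W. g x (W x) * g x' (W x')))"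
    by (simp add: power2_eq_square sum_product int)
  also have "\<dots> = (\<Sum>x\<in>A. \<Sum>x'\<in>A. if x' = x then measure_pmf.variance (p x) (f x) else 0)"
    using off comp[of _ "\<lambda>v. g _ v * g _ v"]
    by (intro sum.cong refl) (auto simp: g_def power2_eq_square)
  also have "\<dots> = (\<Sum>x\<in>A. measure_pmf.variance (p x) (f x))"
    using A by simp
  finally show ?thesis .
qed

text \<open>The full double sum factors into totals, and only its diagonal has to be removed. This
  serves both to count pairs of units within a group and to reduce the final formula to
  totals.\<close>

lemma sum_off_diagonal:
  fixes f g :: "'a \<Rightarrow> real"
  assumes "finite A"
  shows "(\<Sum>k\<in>A. \<Sum>l\<in>A - {k}. f k * g l) = sum f A * sum g A - (\<Sum>k\<in>A. f k * g k)"
  using assms by (simp add: sum_product sum_diff1 sum_subtractf)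

section \<open>Symmetries of the set of balanced assignments\<close>

text \<open>A bijection of a finite nonempty set onto itself preserves its uniform
  distribution.\<close>

lemma expectation_uniform_bij:
  fixes f :: "'a \<Rightarrow> real"
  assumes "bij_betw h A A" "finite A" "A \<noteq> {}"
  shows "measure_pmf.expectation (pmf_of_set A) (\<lambda>w. f (h w)) = measure_pmf.expectation (pmf_of_set A) f"
  using map_pmf_of_set_bij_betw[OF assms(1,3,2)] integral_map_pmf[of h "pmf_of_set A" f] by simp

text \<open>A transposition is an involution. The rule moves a relabelling from the assigned
  treatment to the label it is compared with.\<close>

lemma transpose_eq_swap: "Transposition.transpose s t x = u \<longleftrightarrow> x = Transposition.transpose s t u"
  by (metis transpose_involutory)

lemma card_filter_bij_betw:
  assumes "bij_betw h A A"
  shows "card {u \<in> A. P (h u)} = card {u \<in> A. P u}"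
proof -
  have "{u \<in> h ` A. P u} = h ` {u \<in> A. P (h u)}"
    by auto
  then have "{u \<in> A. P u} = h ` {u \<in> A. P (h u)}"
    by (simp only: bij_betw_imp_surj_on[OF assms])
  moreover have "inj_on h {u \<in> A. P (h u)}"
    by (rule inj_on_subset[OF bij_betw_imp_inj_on[OF assms]]) blast
  ultimately show ?thesis
    by (metis card_image)
qed

lemma group_size_transpose_units:
  assumes "k \<in> {1..m}" "l \<in> {1..m}"
  shows "group_size m (\<lambda>i. w (Transposition.transpose k l i)) u = group_size m w u"
  unfolding group_size_def using assms by (intro card_filter_bij_betw) simp

lemma group_size_transpose_treatments:
  "group_size m (\<lambda>i\<in>{1..m}. Transposition.transpose s t (w i)) u = group_size m w (Transposition.transpose s t u)"
proof -
  have "(\<lambda>i\<in>{1..m}. Transposition.transpose s t (w i)) k = u \<longleftrightarrow> w k = Transposition.transpose s t u"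
    if "k \<in> {1..m}" for k
    using that transpose_eq_swap[of s t "w k" u] by simp
  then show ?thesis
    unfolding group_size_def by (metis (no_types, lifting))
qed

text \<open>Swapping two units of \<open>{1..m}\<close> fixes all indices outside, so extensionality
  is kept, and no group size changes. The map is its own inverse.\<close>

lemma bij_betw_transpose_units:
  assumes "k \<in> {1..m}" "l \<in> {1..m}"
  shows "bij_betw (\<lambda>w i. w (Transposition.transpose k l i)) (balanced_assignments r m) (balanced_assignments r m)"
proof -
  have "(\<lambda>i. w (Transposition.transpose k l i)) \<in> balanced_assignments r m" if "w \<in> balanced_assignments r m" for w
  proof -
    have "(\<lambda>i. w (Transposition.transpose k l i)) \<in> {1..m} \<rightarrow>\<^sub>E {1..r}"
      using that assms unfolding balanced_assignments_def by (auto simp: PiE_iff extensional_def Transposition.transpose_def)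
    then show ?thesis
      using that by (simp add: balanced_assignments_def group_size_transpose_units[OF assms])
  qed
  then show ?thesis
    by (intro bij_betw_byWitness[of _ "\<lambda>w i. w (Transposition.transpose k l i)"]) auto
qed

text \<open>Relabelling permutes the group sizes among the treatments, so the number of larger
  groups is kept. The restriction to \<open>{1..m}\<close> is there because the transposition might
  move the value \<open>undefined\<close> taken outside.\<close>

lemma bij_betw_transpose_treatments:
  assumes "s \<in> {1..r}" "t \<in> {1..r}"
  shows "bij_betw (\<lambda>w. \<lambda>i\<in>{1..m}. Transposition.transpose s t (w i)) (balanced_assignments r m) (balanced_assignments r m)"
proof -
  have tr: "Transposition.transpose s t u \<in> {1..r} \<longleftrightarrow> u \<in> {1..r}" for u
    using assms by (auto simp: Transposition.transpose_def)
  have "(\<lambda>i\<in>{1..m}. Transposition.transpose s t (w i)) \<in> balanced_assignments r m" if w: "w \<in> balanced_assignments r m" for w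
  proof -
    have 1: "(\<lambda>i\<in>{1..m}. Transposition.transpose s t (w i)) \<in> {1..m} \<rightarrow>\<^sub>E {1..r}"
      using w tr unfolding balanced_assignments_def by (auto simp: PiE_iff)
    \<comment> \<open>The reindexing is over treatments here: the transposition permutes
      \<open>{1..r}\<close>.\<close>
    have 2: "card {u \<in> {1..r}. group_size m w (Transposition.transpose s t u) = j} =
        card {u \<in> {1..r}. group_size m w u = j}" for j
      by (rule card_filter_bij_betw) (use assms in simp)
    have 3: "\<forall>u\<in>{1..r}. group_size m w (Transposition.transpose s t u) = m div r + 1 \<or>
        group_size m w (Transposition.transpose s t u) = m div r"
    proof
      fix u assume "u \<in> {1..r}"
      then have "Transposition.transpose s t u \<in> {1..r}" by (simp only: tr)
      with w show "group_size m w (Transposition.transpose s t u) = m div r + 1 \<or>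
          group_size m w (Transposition.transpose s t u) = m div r"
        by (simp add: balanced_assignments_def)
    qed
    from w have "card {u \<in> {1..r}. group_size m w u = m div r + 1} = m mod r"
      by (simp add: balanced_assignments_def)
    with 1 2 3 show ?thesis
      unfolding balanced_assignments_def mem_Collect_eq group_size_transpose_treatments by simp
  qed
  \<comment> \<open>Outside \<open>{1..m}\<close> the two sides agree because \<open>w\<close> is
    extensional.\<close>
  moreover have "(\<lambda>i\<in>{1..m}. Transposition.transpose s t
      ((\<lambda>i\<in>{1..m}. Transposition.transpose s t (w i)) i)) = w" if "w \<in> balanced_assignments r m" for w
    using that by (auto simp: balanced_assignments_def fun_eq_iff PiE_iff extensional_def)
  ultimately show ?thesis
    by (intro bij_betw_byWitness[of _ "\<lambda>w. \<lambda>i\<in>{1..m}. Transposition.transpose s t (w i)"]) blast+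
qed

lemma balanced_assignment_in:
  "w \<in> balanced_assignments r m \<Longrightarrow> k \<in> {1..m} \<Longrightarrow> w k \<in> {1..r}"
  by (auto simp: balanced_assignments_def PiE_iff)

section \<open>Group sizes and expectations under uniform balanced assignment\<close>

lemma sum_group_size_squared:
  assumes "w \<in> balanced_assignments r m"
  shows "(\<Sum>u=1..r. (real (group_size m w u))\<^sup>2) =
    real (m mod r) * (real (m div r) + 1)\<^sup>2 + (real r - real (m mod r)) * (real (m div r))\<^sup>2"
proof -
  let ?B = "{u \<in> {1..r}. group_size m w u = m div r + 1}"
  have c: "card ?B = m mod r"
    and v: "\<forall>u\<in>{1..r}. group_size m w u = m div r + 1 \<or> group_size m w u = m div r"
    using assms by (auto simp: balanced_assignments_def)
  have "(\<Sum>u=1..r. (real (group_size m w u))\<^sup>2) =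
      (\<Sum>u=1..r. (real (m div r))\<^sup>2 + (if u \<in> ?B then (real (m div r) + 1)\<^sup>2 - (real (m div r))\<^sup>2 else 0))"
    using v by (intro sum.cong) auto
  also have "\<dots> = real r * (real (m div r))\<^sup>2 + real (card ?B) * ((real (m div r) + 1)\<^sup>2 - (real (m div r))\<^sup>2)"
    by (simp add: sum.distrib sum.If_cases Int_def conj_commute cong: conj_cong)
  finally show ?thesis unfolding c by (simp add: algebra_simps)
qed

lemma group_size_eq_sum: "real (group_size m w u) = (\<Sum>k=1..m. of_bool (w k = u))"
  by (simp add: group_size_def sum.If_cases of_bool_def Int_def)

lemma integrable_balanced:
  "0 < r \<Longrightarrow> integrable (pmf_of_set (balanced_assignments r m)) (f :: _ \<Rightarrow> real)"
  by (simp add: integrable_measure_pmf_finite set_pmf_of_set finite_balanced_assignments balanced_assignments_nonempty)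

text \<open>The support of the uniform distribution is the set of balanced assignments, so agreement
  there is agreement almost everywhere.\<close>

lemma expectation_balanced_cong:
  fixes f g :: "(nat \<Rightarrow> nat) \<Rightarrow> real"
  assumes "0 < r" "\<And>w. w \<in> balanced_assignments r m \<Longrightarrow> f w = g w"
  shows "measure_pmf.expectation (pmf_of_set (balanced_assignments r m)) f =
    measure_pmf.expectation (pmf_of_set (balanced_assignments r m)) g"
  by (rule integral_cong_AE)
    (use assms in \<open>auto simp: AE_measure_pmf_iff set_pmf_of_set finite_balanced_assignments balanced_assignments_nonempty\<close>)

lemma expectation_transpose_units:
  fixes f :: "(nat \<Rightarrow> nat) \<Rightarrow> real"
  assumes "0 < r" "k \<in> {1..m}" "l \<in> {1..m}"
  shows "measure_pmf.expectation (pmf_of_set (balanced_assignments r m)) (\<lambda>w. f (\<lambda>i. w (Transposition.transpose k l i))) =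
    measure_pmf.expectation (pmf_of_set (balanced_assignments r m)) f"
  using assms by (intro expectation_uniform_bij[OF bij_betw_transpose_units])
    (auto simp: finite_balanced_assignments balanced_assignments_nonempty)

lemma expectation_transpose_treatments:
  fixes f :: "(nat \<Rightarrow> nat) \<Rightarrow> real"
  assumes "s \<in> {1..r}" "t \<in> {1..r}"
  shows "measure_pmf.expectation (pmf_of_set (balanced_assignments r m)) (\<lambda>w. f (\<lambda>i\<in>{1..m}. Transposition.transpose s t (w i))) =
    measure_pmf.expectation (pmf_of_set (balanced_assignments r m)) f"
  using assms by (intro expectation_uniform_bij[OF bij_betw_transpose_treatments])
    (auto simp: finite_balanced_assignments balanced_assignments_nonempty)

section \<open>Assignment probabilities of one and of two units\<close>

text \<open>The indicators of the \<open>r\<close> treatments at one unit sum to 1, and treatment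
  symmetry gives them equal means.\<close>

lemma prob_treated:
  assumes k: "k \<in> {1..m}" and s: "s \<in> {1..r}"
  shows "measure_pmf.expectation (pmf_of_set (balanced_assignments r m)) (\<lambda>w. of_bool (w k = s)) = 1 / real r"
proof -
  let ?E = "measure_pmf.expectation (pmf_of_set (balanced_assignments r m)) :: _ \<Rightarrow> real"
  have r: "0 < r" using s by auto
  have "?E (\<lambda>w. of_bool (w k = u)) = ?E (\<lambda>w. of_bool (w k = s) :: real)" if "u \<in> {1..r}" for u
    using expectation_transpose_treatments[OF s that, of m "\<lambda>w. of_bool (w k = s)"] k
    by (simp add: transpose_eq_swap)
  then have "real r * ?E (\<lambda>w. of_bool (w k = s)) = (\<Sum>u=1..r. ?E (\<lambda>w. of_bool (w k = u)))"
    by simp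
  also have "\<dots> = ?E (\<lambda>w. \<Sum>u=1..r. of_bool (w k = u))"
    by (simp add: integrable_balanced[OF r] del: sum_of_bool_eq)
  also have "\<dots> = ?E (\<lambda>w. 1)"
    using balanced_assignment_in[OF _ k]
    by (intro expectation_balanced_cong[OF r]) (auto simp: of_bool_def)
  finally show ?thesis using r by (simp add: field_simps)
qed

text \<open>Any ordered pair of distinct units can be turned into any other by exchanging its
  entries and replacing one entry at a time, and both moves preserve the probability.\<close>

lemma prob_both_treated_same_any_units:
  assumes r: "0 < r"
    and k: "k \<in> {1..m}" "l \<in> {1..m}" "k \<noteq> l"
    and k': "k' \<in> {1..m}" "l' \<in> {1..m}" "k' \<noteq> l'"
  shows "measure_pmf.expectation (pmf_of_set (balanced_assignments r m)) (\<lambda>w. of_bool (w k = s) * of_bool (w l = s)) =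
    (measure_pmf.expectation (pmf_of_set (balanced_assignments r m)) (\<lambda>w. of_bool (w k' = s) * of_bool (w l' = s)) :: real)"
    (is "?P k l = ?P k' l'")
proof -
  have sym: "?P i j = ?P j i" for i j by (simp add: mult.commute)
  \<comment> \<open>The transposition of \<open>j\<close> and \<open>j'\<close> fixes
    \<open>i\<close>, which differs from both.\<close>
  have move: "?P i j = ?P i j'" if "i \<in> {1..m}" "j \<in> {1..m}" "j' \<in> {1..m}" "i \<noteq> j" "i \<noteq> j'" for i j j'
    using expectation_transpose_units[OF r that(2,3), of "\<lambda>w. of_bool (w i = s) * of_bool (w j' = s)"] that
    by simp
  show ?thesis
  \<comment> \<open>In general the path is \<open>(k,l)\<close>, \<open>(l,k)\<close>,
    \<open>(l,k')\<close>, \<open>(k',l)\<close>, \<open>(k',l')\<close>. For \<open>k' = l\<close>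
    the third pair would not be distinct, and \<open>(l,k)\<close> moves to \<open>(l,l')\<close>
    directly.\<close>
  proof (cases "k' = l")
    case True
    then show ?thesis using sym[of k l] move[of l k l'] k k' by simp
  next
    case False
    then show ?thesis using move[of l k k'] move[of k' l l'] sym[of k l] sym[of l k'] k k' by simp
  qed
qed

text \<open>Double counting: \<open>r * m * (m - 1)\<close> times the probability is the expected
  number of ordered pairs of distinct units sharing a treatment. That number is the sum of the
  squared group sizes minus \<open>m\<close>, a constant.\<close>

lemma prob_both_treated_same:
  assumes k: "k \<in> {1..m}" "l \<in> {1..m}" "k \<noteq> l" and s: "s \<in> {1..r}"
  shows "measure_pmf.expectation (pmf_of_set (balanced_assignments r m))
      (\<lambda>w. of_bool (w k = s) * of_bool (w l = s)) =
    (real m * (real m - real r) + real (m mod r) * (real r - real (m mod r))) /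
      ((real r)\<^sup>2 * real m * (real m - 1))"
proof -
  let ?E = "measure_pmf.expectation (pmf_of_set (balanced_assignments r m)) :: _ \<Rightarrow> real"
  let ?p = "?E (\<lambda>w. of_bool (w k = s) * of_bool (w l = s))"
  let ?q = "real (m div r)" and ?z = "real (m mod r)"
  have r: "0 < r" using s by auto
  have m: "1 < m" using k by auto
  have mq: "real m = real r * ?q + ?z"
    by (metis mult_div_mod_eq of_nat_add of_nat_mult)
  have *: "?E (\<lambda>w. of_bool (w i = u) * of_bool (w j = u)) = ?p"
    if "u \<in> {1..r}" "i \<in> {1..m}" "j \<in> {1..m} - {i}" for u i j
  proof -
    have "?E (\<lambda>w. of_bool (w i = u) * of_bool (w j = u)) = ?E (\<lambda>w. of_bool (w k = u) * of_bool (w l = u) :: real)"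
      using that k by (intro prob_both_treated_same_any_units r) auto
    also have "\<dots> = ?p"
      using expectation_transpose_treatments[OF s that(1), of m "\<lambda>w. of_bool (w k = s) * of_bool (w l = s)"] k
      by (simp add: transpose_eq_swap)
    finally show ?thesis .
  qed
  have "real r * (real m * (real m - 1)) * ?p = (\<Sum>u=1..r. \<Sum>i=1..m. \<Sum>j\<in>{1..m} - {i}. ?p)"
    using m by (simp add: of_nat_diff)
  also have "\<dots> = (\<Sum>u=1..r. \<Sum>i=1..m. \<Sum>j\<in>{1..m} - {i}. ?E (\<lambda>w. of_bool (w i = u) * of_bool (w j = u)))"
    by (intro sum.cong refl *[symmetric])
  also have "\<dots> = ?E (\<lambda>w. \<Sum>u=1..r. \<Sum>i=1..m. \<Sum>j\<in>{1..m} - {i}. of_bool (w i = u) * of_bool (w j = u))"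
    by (simp add: integrable_balanced[OF r] del: sum_of_bool_eq sum_mult_of_bool_eq sum_of_bool_mult_eq)
  also have "\<dots> = ?E (\<lambda>w. ?z * (?q + 1)\<^sup>2 + (real r - ?z) * ?q\<^sup>2 - real m)"
  proof (rule expectation_balanced_cong[OF r])
    fix w assume w: "w \<in> balanced_assignments r m"
    \<comment> \<open>A group of \<open>N\<close> units contains \<open>N * N - N\<close> ordered
      pairs of distinct units. The diagonal yields \<open>N\<close> since indicators are
      idempotent.\<close>
    have "(\<Sum>u=1..r. \<Sum>i=1..m. \<Sum>j\<in>{1..m} - {i}. of_bool (w i = u) * of_bool (w j = u)) =
        (\<Sum>u=1..r. (real (group_size m w u))\<^sup>2 - (\<Sum>i=1..m. of_bool (w i = u)))"
      unfolding sum_off_diagonal[OF finite_atLeastAtMost] group_size_eq_sum power2_eq_square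
      by (simp add: of_bool_conj[symmetric] del: sum_of_bool_eq)
    also have "\<dots> = (\<Sum>u=1..r. (real (group_size m w u))\<^sup>2) - (\<Sum>i=1..m. \<Sum>u=1..r. of_bool (w i = u))"
      by (subst sum.swap) (simp add: sum_subtractf del: sum_of_bool_eq)
    \<comment> \<open>Every unit receives exactly one treatment.\<close>
    also have "(\<Sum>i=1..m. \<Sum>u=1..r. of_bool (w i = u)) = (\<Sum>i=1..m. 1 :: real)"
      using balanced_assignment_in[OF w] by (intro sum.cong refl) (auto simp: of_bool_def)
    finally show "(\<Sum>u=1..r. \<Sum>i=1..m. \<Sum>j\<in>{1..m} - {i}. of_bool (w i = u) * of_bool (w j = u)) =
        ?z * (?q + 1)\<^sup>2 + (real r - ?z) * ?q\<^sup>2 - real m"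
      using sum_group_size_squared[OF w] by simp
  qed
  \<comment> \<open>The extra factor \<open>r\<close> completes the square
    \<open>(r * q + z)\<^sup>2\<close>, so that the quotient disappears from the result.\<close>
  finally have "real r * (real r * (real m * (real m - 1)) * ?p) = real r * (?z * (?q + 1)\<^sup>2 + (real r - ?z) * ?q\<^sup>2 - real m)"
    by simp
  also have "\<dots> = real m * (real m - real r) + ?z * (real r - ?z)"
    unfolding mq by (simp add: algebra_simps power2_eq_square)
  finally have "?p * ((real r)\<^sup>2 * real m * (real m - 1)) = real m * (real m - real r) + ?z * (real r - ?z)"
    by (simp add: algebra_simps power2_eq_square)
  then show ?thesis using r m by (intro eq_divide_imp) auto
qed

text \<open>The \<open>r - 1\<close> treatments other than \<open>s\<close> are equally likely for
  the second unit jointly with \<open>s\<close> at the first. Their joint probabilities add up to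
  \<open>1 / r\<close> minus the probability that both units receive \<open>s\<close>.\<close>

lemma prob_treated_different:
  assumes k: "k \<in> {1..m}" "l \<in> {1..m}" "k \<noteq> l"
    and s: "s \<in> {1..r}" and t: "t \<in> {1..r}" and st: "s \<noteq> t"
  shows "measure_pmf.expectation (pmf_of_set (balanced_assignments r m))
      (\<lambda>w. of_bool (w k = s) * of_bool (w l = t)) =
    (real m * real m * (real r - 1) - real (m mod r) * (real r - real (m mod r))) /
      ((real r)\<^sup>2 * real m * (real m - 1) * (real r - 1))"
proof -
  let ?E = "measure_pmf.expectation (pmf_of_set (balanced_assignments r m)) :: _ \<Rightarrow> real"
  let ?p = "?E (\<lambda>w. of_bool (w k = s) * of_bool (w l = t))"
  let ?p2 = "(real m * (real m - real r) + real (m mod r) * (real r - real (m mod r))) /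
      ((real r)\<^sup>2 * real m * (real m - 1))"
  have r: "0 < r" "1 < r" using s t st by auto
  have m: "1 < m" using k by auto
  \<comment> \<open>Both \<open>t\<close> and \<open>u\<close> differ from \<open>s\<close>, so
    transposing them leaves the condition on unit \<open>k\<close> alone.\<close>
  have *: "?E (\<lambda>w. of_bool (w k = s) * of_bool (w l = u)) = ?p" if "u \<in> {1..r} - {s}" for u
    using expectation_transpose_treatments[of t r u m "\<lambda>w. of_bool (w k = s) * of_bool (w l = t)"] that k t st
    by (simp add: transpose_eq_swap)
  have "(real r - 1) * ?p = (\<Sum>u\<in>{1..r} - {s}. ?p)"
    using s r by (simp add: of_nat_diff)
  also have "\<dots> = (\<Sum>u\<in>{1..r} - {s}. ?E (\<lambda>w. of_bool (w k = s) * of_bool (w l = u)))"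
    by (intro sum.cong refl *[symmetric])
  also have "\<dots> = ?E (\<lambda>w. \<Sum>u\<in>{1..r} - {s}. of_bool (w k = s) * of_bool (w l = u))"
    by (simp add: integrable_balanced r del: sum_of_bool_eq sum_mult_of_bool_eq sum_of_bool_mult_eq)
  also have "\<dots> = ?E (\<lambda>w. of_bool (w k = s) - of_bool (w k = s) * of_bool (w l = s))"
  proof (rule expectation_balanced_cong[OF r(1)])
    fix w assume "w \<in> balanced_assignments r m"
    then have "(\<Sum>u=1..r. of_bool (w l = u) :: real) = 1"
      using balanced_assignment_in[of w r m l] k by (auto simp: of_bool_def)
    then show "(\<Sum>u\<in>{1..r} - {s}. of_bool (w k = s) * of_bool (w l = u)) =
        (of_bool (w k = s) - of_bool (w k = s) * of_bool (w l = s) :: real)"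
      using s by (simp add: sum_distrib_left[symmetric] sum_diff1 algebra_simps
          del: sum_of_bool_eq sum_mult_of_bool_eq sum_of_bool_mult_eq)
  qed
  also have "\<dots> = ?E (\<lambda>w. of_bool (w k = s)) - ?E (\<lambda>w. of_bool (w k = s) * of_bool (w l = s))"
    by (intro Bochner_Integration.integral_diff integrable_balanced r)
  also have "\<dots> = 1 / real r - ?p2"
    by (simp only: prob_treated[OF k(1) s] prob_both_treated_same[OF k s])
  \<comment> \<open>Over the common denominator, \<open>r * m * (m - 1) - m * (m - r)\<close>
    collapses to \<open>m * m * (r - 1)\<close>.\<close>
  also have "\<dots> = (real m * real m * (real r - 1) - real (m mod r) * (real r - real (m mod r))) /
      ((real r)\<^sup>2 * real m * (real m - 1))"
    using r m by (simp add: divide_simps) (simp add: algebra_simps power2_eq_square)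
  finally have e: "(real r - 1) * ?p = (real m * real m * (real r - 1) - real (m mod r) * (real r - real (m mod r))) /
      ((real r)\<^sup>2 * real m * (real m - 1))" .
  have "?p = (real r - 1) * ?p / (real r - 1)"
    using r by simp
  also have "\<dots> = (real m * real m * (real r - 1) - real (m mod r) * (real r - real (m mod r))) /
      ((real r)\<^sup>2 * real m * (real m - 1) * (real r - 1))"
    by (simp only: e divide_divide_eq_left)
  finally show ?thesis .
qed

section \<open>Mean and variance of the contrast within one block\<close>

lemma expectation_block_contrast:
  fixes a b :: "nat \<Rightarrow> real"
  assumes "s \<in> {1..r}" "t \<in> {1..r}"
  shows "measure_pmf.expectation (pmf_of_set (balanced_assignments r m))
      (\<lambda>w. \<Sum>k=1..m. a k * of_bool (w k = s) - b k * of_bool (w k = t)) =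
    (\<Sum>k=1..m. a k - b k) / real r"
proof -
  have r: "0 < r" using assms by auto
  show ?thesis
    by (simp add: integrable_balanced[OF r] prob_treated[OF _ assms(1)] prob_treated[OF _ assms(2)]
          sum_divide_distrib diff_divide_distrib cong: sum.cong_simp
        del: sum_of_bool_eq sum_mult_of_bool_eq sum_of_bool_mult_eq)
qed

text \<open>Second moment minus squared mean, the second moment being expanded over pairs of units.
  Here \<open>p\<close> is the probability that two distinct units both receive a given treatment,
  and \<open>p'\<close> that they receive two given different ones.\<close>

lemma variance_block_contrast:
  fixes m r s t :: nat and a b :: "nat \<Rightarrow> real"
  assumes s: "s \<in> {1..r}" and t: "t \<in> {1..r}" and st: "s \<noteq> t"
  defines "p \<equiv> (real m * (real m - real r) + real (m mod r) * (real r - real (m mod r))) /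
      ((real r)\<^sup>2 * real m * (real m - 1))"
    and "p' \<equiv> (real m * real m * (real r - 1) - real (m mod r) * (real r - real (m mod r))) /
      ((real r)\<^sup>2 * real m * (real m - 1) * (real r - 1))"
  shows "measure_pmf.variance (pmf_of_set (balanced_assignments r m))
      (\<lambda>w. \<Sum>k=1..m. a k * of_bool (w k = s) - b k * of_bool (w k = t)) =
    (\<Sum>k=1..m. (a k)\<^sup>2 + (b k)\<^sup>2) / real r +
    (\<Sum>k=1..m. \<Sum>l\<in>{1..m} - {k}. p * (a k * a l + b k * b l) - 2 * p' * (a k * b l)) -
    ((\<Sum>k=1..m. a k - b k) / real r)\<^sup>2"
proof -
  let ?U = "pmf_of_set (balanced_assignments r m)"
  let ?E = "measure_pmf.expectation ?U :: _ \<Rightarrow> real"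
  define X where "X k w = a k * of_bool (w k = s) - b k * of_bool (w k = t)" for k and w :: "nat \<Rightarrow> nat"
  have r: "0 < r" using s by auto
  note int = integrable_balanced[OF r, of m]
  have diag: "?E (\<lambda>w. X k w * X k w) = ((a k)\<^sup>2 + (b k)\<^sup>2) / real r" if "k \<in> {1..m}" for k
  proof -
    \<comment> \<open>No unit receives both \<open>s\<close> and \<open>t\<close>, so the mixed
      product vanishes.\<close>
    have "X k w * X k w = (a k)\<^sup>2 * of_bool (w k = s) + (b k)\<^sup>2 * of_bool (w k = t)" for w
      using st by (auto simp: X_def power2_eq_square)
    then show ?thesis
      using that by (simp add: int prob_treated[OF _ s] prob_treated[OF _ t] add_divide_distrib)
  qed
  have off: "?E (\<lambda>w. X k w * X l w) = p * (a k * a l + b k * b l) - p' * (a k * b l) - p' * (a l * b k)"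
    if "k \<in> {1..m}" "l \<in> {1..m} - {k}" for k l
  proof -
    have kl: "k \<in> {1..m}" "l \<in> {1..m}" "k \<noteq> l" using that by auto
    have "?E (\<lambda>w. X k w * X l w) = ?E (\<lambda>w. a k * a l * (of_bool (w k = s) * of_bool (w l = s))
        + b k * b l * (of_bool (w k = t) * of_bool (w l = t))
        - a k * b l * (of_bool (w k = s) * of_bool (w l = t))
        - a l * b k * (of_bool (w k = t) * of_bool (w l = s)))"
      by (simp add: X_def algebra_simps)
    also have "\<dots> = a k * a l * ?E (\<lambda>w. of_bool (w k = s) * of_bool (w l = s))
        + b k * b l * ?E (\<lambda>w. of_bool (w k = t) * of_bool (w l = t))
        - a k * b l * ?E (\<lambda>w. of_bool (w k = s) * of_bool (w l = t))
        - a l * b k * ?E (\<lambda>w. of_bool (w k = t) * of_bool (w l = s))"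
      by (simp add: int)
    also have "\<dots> = a k * a l * p + b k * b l * p - a k * b l * p' - a l * b k * p'"
      unfolding p_def p'_def prob_both_treated_same[OF kl s] prob_both_treated_same[OF kl t]
        prob_treated_different[OF kl s t st] prob_treated_different[OF kl t s st[symmetric]] ..
    finally show ?thesis by (simp add: algebra_simps)
  qed
  \<comment> \<open>Exchanging the two units of a pair identifies the two mixed sums, which is the
    source of the factor 2.\<close>
  have swap: "(\<Sum>k=1..m. \<Sum>l\<in>{1..m} - {k}. p' * (a l * b k)) = (\<Sum>k=1..m. \<Sum>l\<in>{1..m} - {k}. p' * (a k * b l))"
    using sum_off_diagonal[of "{1..m}" b a] sum_off_diagonal[of "{1..m}" a b]
    by (simp add: sum_distrib_left[symmetric] mult.commute)
  have two: "(\<Sum>k=1..m. \<Sum>l\<in>{1..m} - {k}. 2 * p' * (a k * b l)) =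
      2 * (\<Sum>k=1..m. \<Sum>l\<in>{1..m} - {k}. p' * (a k * b l))"
    by (simp add: sum_distrib_left mult.assoc)
  have "?E (\<lambda>w. (\<Sum>k=1..m. X k w)\<^sup>2) = (\<Sum>k=1..m. \<Sum>l=1..m. ?E (\<lambda>w. X k w * X l w))"
    by (simp add: power2_eq_square sum_product int)
  also have "\<dots> = (\<Sum>k=1..m. ?E (\<lambda>w. X k w * X k w) + (\<Sum>l\<in>{1..m} - {k}. ?E (\<lambda>w. X k w * X l w)))"
    by (intro sum.cong refl sum.remove) auto
  also have "\<dots> = (\<Sum>k=1..m. ((a k)\<^sup>2 + (b k)\<^sup>2) / real r + (\<Sum>l\<in>{1..m} - {k}.
      p * (a k * a l + b k * b l) - p' * (a k * b l) - p' * (a l * b k)))"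
    by (intro sum.cong arg_cong2[of _ _ _ _ plus] refl diag off)
  also have "\<dots> = (\<Sum>k=1..m. (a k)\<^sup>2 + (b k)\<^sup>2) / real r +
      (\<Sum>k=1..m. \<Sum>l\<in>{1..m} - {k}. p * (a k * a l + b k * b l) - 2 * p' * (a k * b l))"
    by (simp only: sum.distrib sum_subtractf add_divide_distrib sum_divide_distrib two swap)
  finally have "?E (\<lambda>w. (\<Sum>k=1..m. X k w)\<^sup>2) = \<dots>" .
  moreover have "?E (\<lambda>w. \<Sum>k=1..m. X k w) = (\<Sum>k=1..m. a k - b k) / real r"
    unfolding X_def by (rule expectation_block_contrast[OF s t])
  ultimately have "measure_pmf.variance ?U (\<lambda>w. \<Sum>k=1..m. X k w) =
    (\<Sum>k=1..m. (a k)\<^sup>2 + (b k)\<^sup>2) / real r +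
    (\<Sum>k=1..m. \<Sum>l\<in>{1..m} - {k}. p * (a k * a l + b k * b l) - 2 * p' * (a k * b l)) -
    ((\<Sum>k=1..m. a k - b k) / real r)\<^sup>2"
    by (subst measure_pmf.variance_eq[OF int int]) simp
  then show ?thesis unfolding X_def .
qed

section \<open>Passage to the block variances and covariance\<close>

text \<open>The mean of the products minus the product of the means, written with totals.\<close>

lemma block_cov_eq:
  assumes "0 < nc c"
  shows "block_cov nc y c s t = (\<Sum>k=1..nc c. y k c s * y k c t) / nc c
    - (\<Sum>k=1..nc c. y k c s) * (\<Sum>k=1..nc c. y k c t) / (real (nc c))\<^sup>2"
proof -
  let ?m = "real (nc c)" and ?a = "\<lambda>k. y k c s" and ?b = "\<lambda>k. y k c t"
  let ?A = "block_mean nc y c s" and ?B = "block_mean nc y c t"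
  have "(\<Sum>k=1..nc c. (?a k - ?A) * (?b k - ?B)) =
      (\<Sum>k=1..nc c. ?a k * ?b k) - ?A * sum ?b {1..nc c} - sum ?a {1..nc c} * ?B + ?m * ?A * ?B"
    by (simp add: algebra_simps sum.distrib sum_subtractf sum_distrib_left)
  moreover have "1 / ?m * (S - 1 / ?m * P * Q - P * (1 / ?m * Q) + ?m * (1 / ?m * P) * (1 / ?m * Q)) =
      S / ?m - P * Q / ?m\<^sup>2" for S P Q
    using assms by (simp add: field_simps power2_eq_square)
  ultimately show ?thesis
    unfolding block_cov_def by (simp only: block_mean_def)
qed

lemma block_var_eq_cov: "block_var nc y c s = block_cov nc y c s s"
  by (simp add: block_var_def block_cov_def power2_eq_square)

text \<open>The rational identity between the two forms of the block variance. \<open>A\<close> and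
  \<open>B\<close> stand for the outcome totals under \<open>s\<close> and \<open>t\<close>,
  \<open>Sa\<close> and \<open>Sb\<close> for the sums of squares, \<open>Sab\<close> for the sum of
  products, and \<open>z\<close> for the remainder. Thus \<open>A * A - Sa\<close> is a sum over
  ordered pairs of distinct units.\<close>

lemma block_variance_algebra:
  fixes m r z A B Sa Sb Sab :: real
  assumes "1 < m" "1 < r"
  shows "r\<^sup>2 * ((Sa + Sb) / r
      + ((m * (m - r) + z * (r - z)) / (r\<^sup>2 * m * (m - 1)) * (A * A - Sa + (B * B - Sb))
         - 2 * ((m * m * (r - 1) - z * (r - z)) / (r\<^sup>2 * m * (m - 1) * (r - 1))) * (A * B - Sab))
      - ((A - B) / r)\<^sup>2) =
    m\<^sup>2 * ((r - 1) / (m - 1) * ((Sa / m - A * A / m\<^sup>2) + (Sb / m - B * B / m\<^sup>2))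
      + 2 * ((Sab / m - A * B / m\<^sup>2) / (m - 1)))
    + m\<^sup>2 * (z * (r - z) / (m ^ 3 * (r - 1))) *
      ((r - 1) / (m - 1) * (A * A - Sa + (B * B - Sb)) + 2 * ((A * B - Sab) / (m - 1)))"
  (is "?L = ?R")
proof -
  \<comment> \<open>The multiplier is nonzero by the assumptions and can be cancelled
    afterwards.\<close>
  have "?L * (m * (m - 1) * (r - 1)) = ?R * (m * (m - 1) * (r - 1))"
    using assms by (simp add: divide_simps) (simp add: algebra_simps power2_eq_square power3_eq_cube)
  then show ?thesis using assms by simp
qed

text \<open>The factor \<open>r\<^sup>2\<close> comes from the inverse probability weights of the
  estimator. The exact second moments are expressed through totals and matched by
  \<open>block_variance_algebra\<close>.\<close>

lemma variance_block_contrast_eq: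
  assumes s: "s \<in> {1..r}" and t: "t \<in> {1..r}" and st: "s \<noteq> t" and m: "r \<le> nc c"
  shows "(real r)\<^sup>2 * measure_pmf.variance (pmf_of_set (balanced_assignments r (nc c)))
      (\<lambda>w. \<Sum>k=1..nc c. y k c s * of_bool (w k = s) - y k c t * of_bool (w k = t)) =
    (real (nc c))\<^sup>2 *
      ((real r - 1) / (real (nc c) - 1) * (block_var nc y c s + block_var nc y c t)
       + 2 * (block_cov nc y c s t / (real (nc c) - 1))) +
    (real (nc c))\<^sup>2 *
      (real (nc c mod r) * (real r - real (nc c mod r)) / ((real (nc c)) ^ 3 * (real r - 1))) *
      (\<Sum>k=1..nc c. \<Sum>l\<in>{1..nc c} - {k}.
         (real r - 1) / (real (nc c) - 1) * (y k c s * y l c s + y k c t * y l c t)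
         + 2 * (y k c s * y l c t / (real (nc c) - 1)))"
proof -
  let ?m = "nc c"
  let ?O = "\<lambda>u v. sum (\<lambda>k. y k c u) {1..?m} * sum (\<lambda>k. y k c v) {1..?m} - (\<Sum>k=1..?m. y k c u * y k c v)"
  \<comment> \<open>Two distinct treatments force at least two treatments, hence at least two units
    in the block, so \<open>nc c - 1\<close> and \<open>r - 1\<close> are nonzero.\<close>
  have r: "1 < r" using s t st by auto
  with m have m1: "1 < ?m" by simp
  \<comment> \<open>One identity with free coefficients covers both double sums: \<open>q\<close>
    becomes \<open>- 2 * p'\<close> for the variance formula and \<open>2 / (nc c - 1)\<close> for
    the target.\<close>
  have off: "(\<Sum>k=1..?m. \<Sum>l\<in>{1..?m} - {k}. p * (y k c s * y l c s + y k c t * y l c t) + q * (y k c s * y l c t)) =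
      p * (?O s s + ?O t t) + q * ?O s t" for p q
    unfolding sum_off_diagonal[OF finite_atLeastAtMost, symmetric]
    by (simp only: sum.distrib sum_distrib_left distrib_left)
  have off1: "(\<Sum>k=1..?m. \<Sum>l\<in>{1..?m} - {k}. p * (y k c s * y l c s + y k c t * y l c t) - 2 * q * (y k c s * y l c t)) =
      p * (?O s s + ?O t t) - 2 * q * ?O s t" for p q
    using off[of p "- (2 * q)"] by simp
  have off2: "(\<Sum>k=1..?m. \<Sum>l\<in>{1..?m} - {k}. p * (y k c s * y l c s + y k c t * y l c t) + 2 * (y k c s * y l c t / q)) =
      p * (?O s s + ?O t t) + 2 * (?O s t / q)" for p q
    using off[of p "2 / q"] by simp
  show ?thesis
    unfolding variance_block_contrast[OF s t st] off1 off2 block_var_eq_cov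
    unfolding block_cov_eq[of nc c, OF less_trans[OF zero_less_one m1]] sum_subtractf sum.distrib power2_eq_square[of "y _ _ _"]
    by (rule block_variance_algebra) (use r m1 in auto)
qed

section \<open>Summation over the blocks\<close>

theorem theorem5:
  fixes n r b :: nat
    and nc :: "nat \<Rightarrow> nat"
    and y :: "nat \<Rightarrow> nat \<Rightarrow> nat \<Rightarrow> real"
    and s t :: nat
  assumes "n = (\<Sum>c=1..b. nc c)"
    and "\<And>c. c \<in> {1..b} \<Longrightarrow> r \<le> nc c"
    and "s \<in> {1..r}" and "t \<in> {1..r}" and "s \<noteq> t"
  shows "measure_pmf.expectation (balanced_block_randomization r b nc)
           (horvitz_thompson n r b nc y s t) = sample_ate n b nc y s t \<and>
         measure_pmf.variance (balanced_block_randomization r b nc)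
           (horvitz_thompson n r b nc y s t) =
         (\<Sum>c=1..b. (real (nc c))\<^sup>2 / (real n)\<^sup>2 *
            ((real r - 1) / (real (nc c) - 1) * (block_var nc y c s + block_var nc y c t)
             + 2 * (block_cov nc y c s t / (real (nc c) - 1))))
         + (\<Sum>c=1..b. (real (nc c))\<^sup>2 / (real n)\<^sup>2 *
            (real (nc c mod r) * (real r - real (nc c mod r)) / ((real (nc c)) ^ 3 * (real r - 1))) *
            (\<Sum>k=1..nc c. \<Sum>l\<in>{1..nc c} - {k}.
               (real r - 1) / (real (nc c) - 1) * (y k c s * y l c s + y k c t * y l c t)
               + 2 * (y k c s * y l c t / (real (nc c) - 1))))"
proof -
  let ?U = "\<lambda>c. pmf_of_set (balanced_assignments r (nc c))"
  let ?D = "\<lambda>c w. \<Sum>k=1..nc c. y k c s * of_bool (w k = s) - y k c t * of_bool (w k = t)"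
  let ?P = "balanced_block_randomization r b nc"
  have r: "0 < r" using assms(3) by simp
  have fin: "finite (set_pmf (?U c))" for c
    by (simp add: r finite_balanced_assignments balanced_assignments_nonempty)
  have pos: "0 < nc c" if "c \<in> {1..b}" for c
    using assms(2)[OF that] r by simp
  \<comment> \<open>The block size cancels between the weight \<open>nc c / n\<close> and the
    divisor \<open>nc c / r\<close>, leaving the common factor \<open>r / n\<close>.\<close>
  have ht: "horvitz_thompson n r b nc y s t = (\<lambda>W. \<Sum>c=1..b. real r / real n * ?D c (W c))"
  proof
    fix W
    show "horvitz_thompson n r b nc y s t W = (\<Sum>c=1..b. real r / real n * ?D c (W c))"
      unfolding horvitz_thompson_def treated_def sum_distrib_left
    proof (intro sum.cong refl)
      fix c k assume "c \<in> {1..b}"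
      then show "real (nc c) / real n * (y k c s * of_bool (W c k = s) / (real (nc c) / real r)
          - y k c t * of_bool (W c k = t) / (real (nc c) / real r)) =
        real r / real n * (y k c s * of_bool (W c k = s) - y k c t * of_bool (W c k = t))"
        using pos[of c] by (simp add: diff_divide_distrib[symmetric])
    qed
  qed
  have "finite (set_pmf ?P)"
    unfolding balanced_block_randomization_def using fin
    by (auto simp: set_Pi_pmf intro!: finite_PiE_dflt)
  then have int: "integrable ?P h" for h :: "_ \<Rightarrow> real"
    by (rule integrable_measure_pmf_finite)
  have mean: "measure_pmf.expectation ?P (\<lambda>W. ?D c (W c)) = (\<Sum>k=1..nc c. y k c s - y k c t) / real r"
    if "c \<in> {1..b}" for c
  proof -
    have "measure_pmf.expectation ?P (\<lambda>W. ?D c (W c)) = measure_pmf.expectation (?U c) (?D c)"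
      using Pi_pmf_component[of "{1..b}" c undefined ?U] that
        integral_map_pmf[of "\<lambda>W. W c" ?P "?D c"]
      unfolding balanced_block_randomization_def by simp
    then show ?thesis
      using expectation_block_contrast[OF assms(3,4)] by simp
  qed
  have "measure_pmf.expectation ?P (horvitz_thompson n r b nc y s t) =
      (\<Sum>c=1..b. real r / real n * measure_pmf.expectation ?P (\<lambda>W. ?D c (W c)))"
    unfolding ht
    by (subst Bochner_Integration.integral_sum[OF int]) (intro sum.cong refl integral_mult_right_zero)
  \<comment> \<open>The factor \<open>r\<close> cancels the treatment probability
    \<open>1 / r\<close>, which gives unbiasedness.\<close>
  also have "\<dots> = (\<Sum>c=1..b. 1 / real n * (\<Sum>k=1..nc c. y k c s - y k c t))"
    using r by (intro sum.cong refl) (simp only: mean, simp)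
  also have "\<dots> = sample_ate n b nc y s t"
    by (simp only: sample_ate_def sum_distrib_left)
  finally have E: "measure_pmf.expectation ?P (horvitz_thompson n r b nc y s t) = sample_ate n b nc y s t" .
  have "measure_pmf.variance ?P (horvitz_thompson n r b nc y s t) =
      (\<Sum>c=1..b. measure_pmf.variance (?U c) (\<lambda>w. real r / real n * ?D c w))"
    unfolding ht balanced_block_randomization_def by (rule variance_sum_Pi_pmf) (use fin in auto)
  also have "\<dots> = (\<Sum>c=1..b. (real r)\<^sup>2 * measure_pmf.variance (?U c) (?D c) / (real n)\<^sup>2)"
    unfolding variance_mult_left by (simp only: power_divide times_divide_eq_left)
  finally have V: "measure_pmf.variance ?P (horvitz_thompson n r b nc y s t) = \<dots>" .
  \<comment> \<open>The two sums over blocks are merged, so that the variance can be compared block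
    by block.\<close>
  show ?thesis
    unfolding V sum.distrib[symmetric]
    by (intro conjI E sum.cong refl, subst variance_block_contrast_eq[OF assms(3-5)])
      (use assms(2) in \<open>simp_all add: add_divide_distrib\<close>)
qed

end
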